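(* For all integers $n,r,s\geq1$ and every integer $p$ with $1\le p\le r$ one has $$r!\sum_{\substack{|\mu|=n\\ l(\mu)=p}} \frac{\left\langle {\mu \atop r}\right\rangle}{z_\mu}\left(\sum_{i=1}^{l(\mu)}\frac{(\mu_i)_s}{s!}\right)=\binom{n+s-1}{n-r}\left(\sum_{j=p}^{r}\binom{j}{p-1}\,|s(r,j)|\,s^{j-p}\right),$$ where the sum on the left is over all partitions $\mu$ of weight $n$ and length $p$.
   Context: A partition $\mu=(\mu_1,\ldots,\mu_l)$ is a finite weakly decreasing sequence of positive integers; $l(\mu)=l$ is its length, $|\mu|=\sum_i\mu_i$ its weight, and $m_i(\mu)=\#\{j:\mu_j=i\}$ the multiplicity of $i\ge1$ in $\mu$. Put $z_\mu=\prod_{i\ge1} i^{m_i(\mu)}\,m_i(\mu)!$. The (Ferrers) diagram of $\mu$ is $\{(i,j):1\le i\le l(\mu),\ 1\le j\le\mu_i\}$. For an integer $r\ge1$, $\left\langle {\mu \atop r}\right\rangle$ denotes the number of ways to choose $r$ points in the diagram of $\mu$ (i.e. the number of $r$-element subsets) such that at least one point is chosen in each row of $\mu$; equivalently $\sum_{r\ge1}\left\langle {\mu \atop r}\right\rangle q^r=\prod_{i=1}^{l(\mu)}\big((1+q)^{\mu_i}-1\big)$. Rising factorial: $(a)_s=a(a+1)\cdots(a+s-1)$. The Stirling numbers of the first kind $s(n,k)$ (not to be confused with the integer $s$) are defined by $X(X-1)\cdots(X-n+1)=\sum_{k\ge1}s(n,k)X^k$, so that $X(X+1)\cdots(X+n-1)=\sum_{k\ge1}|s(n,k)|X^k$,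 for $n\ge1$. Binomial coefficients with negative lower index are $0$. *)

theory Defs
  imports Complex_Main "HOL-Computational_Algebra.Polynomial" "HOL-Combinatorics.Stirling"
begin

definition is_partition :: "nat list \<Rightarrow> bool" where
  "is_partition \<mu> \<longleftrightarrow> sorted_wrt (\<ge>) \<mu> \<and> (\<forall>k\<in>set \<mu>. k \<ge> 1)"

text \<open>Parts are numbered from 1, list positions from 0.\<close>

definition part :: "nat list \<Rightarrow> nat \<Rightarrow> nat" where
  "part \<mu> i = \<mu> ! (i - 1)"

definition partitions :: "nat \<Rightarrow> nat \<Rightarrow> nat list set" where
  "partitions n p = {\<mu>. is_partition \<mu> \<and> sum_list \<mu> = n \<and> length \<mu> = p}"

text \<open>A multiplicity of zero contributes the factor 1, so only the values that
  occur in the partition are multiplied.\<close>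

definition z_part :: "nat list \<Rightarrow> nat" where
  "z_part \<mu> = (\<Prod>i\<in>set \<mu>. i ^ count_list \<mu> i * fact (count_list \<mu> i))"

definition diagram :: "nat list \<Rightarrow> (nat \<times> nat) set" where
  "diagram \<mu> = {(i, j). 1 \<le> i \<and> i \<le> length \<mu> \<and> 1 \<le> j \<and> j \<le> part \<mu> i}"

definition row_choices :: "nat list \<Rightarrow> nat \<Rightarrow> nat" where
  "row_choices \<mu> r = card {S. S \<subseteq> diagram \<mu> \<and> card S = r \<and>
     (\<forall>i\<in>{1..length \<mu>}. \<exists>j. (i, j) \<in> S)}"

text \<open>Signed Stirling numbers of the first kind: the coefficients of
  \<open>X (X - 1) \<dots> (X - n + 1)\<close>. The constant \<open>stirling\<close> of the library is
  the unsigned version.\<close>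

definition stirling_first :: "nat \<Rightarrow> nat \<Rightarrow> int" where
  "stirling_first n k = coeff (\<Prod>i<n. [:- int i, 1:]) k"

lemma finite_partitions: "finite (partitions n p)"
proof (rule finite_subset)
  show "partitions n p \<subseteq> {\<mu>. set \<mu> \<subseteq> {..n} \<and> length \<mu> = p}"
    by (auto simp: partitions_def intro: member_le_sum_list)
qed (simp add: finite_lists_length_eq)

lemma finite_diagram: "finite (diagram \<mu>)"
proof (rule finite_subset)
  show "diagram \<mu> \<subseteq> (SIGMA i:{1..length \<mu>}. {1..part \<mu> i})"
    by (auto simp: diagram_def)
qed auto

lemma stirling_first_eq: "stirling_first n k = (-1) ^ (n + k) * int (stirling n k)"
proof (induction n arbitrary: k)
  case 0
  then show ?case by (cases k) (simp_all add: stirling_first_def)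
next
  case (Suc n)
  have rec: "stirling_first (Suc n) k =
      (case k of 0 \<Rightarrow> 0 | Suc l \<Rightarrow> stirling_first n l) - int n * stirling_first n k"
    by (simp add: stirling_first_def mult.commute[of "prod _ _"] coeff_pCons split: nat.split)
  show ?case
  proof (cases k)
    case 0
    then show ?thesis using rec Suc.IH by (cases n) simp_all
  next
    case (Suc l)
    then show ?thesis using rec Suc.IH by (simp add: algebra_simps)
  qed
qed

lemma abs_stirling_first: "\<bar>stirling_first n k\<bar> = int (stirling n k)"
  by (simp add: stirling_first_eq abs_mult power_abs)

end

theory Submission
  imports Defs "HOL-Computational_Algebra.Formal_Power_Series"
    "HOL-Combinatorics.Multiset_Permutations"
begin

text \<open>
  Dividing by \<open>z_part \<mu>\<close> is, up to the factor \<open>p!\<close>, the same as summing over the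
  rearrangements of \<open>\<mu>\<close> with weight \<open>1 / (\<mu>\<^sub>1 \<dots> \<mu>\<^sub>p)\<close>: a partition has
  \<open>p! / \<Prod> m\<^sub>i!\<close> rearrangements (\<open>sum_partitions_eq_sum_compositions\<close>). So the left-hand
  side becomes a sum over compositions \<open>a\<close> of \<open>n\<close>. The number of choices of points splits
  according to the numbers \<open>b\<^sub>i\<close> of points in the rows, which form a composition of \<open>r\<close>
  with summand \<open>\<Prod> (a\<^sub>i choose b\<^sub>i)\<close> (\<open>row_choices_eq\<close>). Finally the inner sum over the
  parts is expanded; each of its \<open>p\<close> terms marks one part. What remains is a double sum over
  \<open>a\<close> and \<open>b\<close> of products over the rows, where a row contributes
  \<open>(a\<^sub>i choose b\<^sub>i) (a\<^sub>i)\<^sub>t / (t! a\<^sub>i)\<close>, with \<open>t = s\<close> in the marked row and \<open>t = 0\<close> in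
  the others.

  The heart of the proof is that such a factor, as a function of \<open>a\<^sub>i\<close>, is a constant times a
  single binomial coefficient (\<open>weight_mult_row_fps\<close>):
  \<open>(a choose b) (a)\<^sub>t / (t! a) = ((b)\<^sub>t / (t! b)) (a + t - 1 choose b + t - 1)\<close>.
  Its generating function in \<open>a\<close> is a multiple of \<open>X\<^sup>b / (1 - X)\<^bsup>b+t\<^esup>\<close>. Multiplying over the
  rows gives \<open>X\<^sup>r / (1 - X)\<^bsup>r+s\<^esup>\<close>, which no longer depends on \<open>b\<close>. Hence summing over
  \<open>a\<close> first produces the factor \<open>(n + s - 1 choose n - r)\<close>, and the remaining sum over
  \<open>b\<close> is a coefficient of a product of univariate series
  (\<open>sum_compositions_weight\<close>), namely
  \<open>[X\<^sup>r] ((1 - X)\<^bsup>-s\<^esup> - 1) / s \<cdot> L\<^bsup>p-1\<^esup>\<close> with \<open>L = - log (1 - X)\<close>.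

  Since \<open>(1 - X)\<^bsup>-s\<^esup> = exp (s L)\<close>, this is a combination of coefficients of powers of
  \<open>L\<close>, and those are Stirling numbers: \<open>r! [X\<^sup>r] L\<^sup>j = j! |s(r, j)|\<close> (\<open>stirling_egf\<close>).
  Collecting terms gives the sum over \<open>j\<close> (\<open>weight_fps_mult_power_nth\<close>).
\<close>

unbundle fps_syntax

section \<open>Products of formal power series\<close>

lemma natpermuteD:
  assumes "v \<in> natpermute n k"
  shows "length v = k" "sum_list v = n" "(\<Sum>i<k. v ! i) = n"
proof -
  show l: "length v = k" and s: "sum_list v = n"
    using assms by (auto simp: natpermute_def)
  show "(\<Sum>i<k. v ! i) = n"
    using l s by (simp add: sum_list_sum_nth atLeast0LessThan)
qed

lemma fps_prod_lessThan_nth: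
  fixes f :: "nat \<Rightarrow> 'a::comm_ring_1 fps"
  shows "(\<Prod>i<k. f i) $ n = (\<Sum>v\<in>natpermute n k. \<Prod>i<k. f i $ (v ! i))"
proof (cases k)
  case 0
  then show ?thesis by (simp add: natpermute_0)
next
  case (Suc m)
  have "{..<Suc m} = {0..m}" by auto
  then show ?thesis using fps_prod_nth[of f m n] by (simp add: Suc)
qed

lemma inverse_one_minus_fps_X_power_nth:
  assumes "k > 0"
  shows "inverse ((1 - fps_X) ^ k :: rat fps) $ n = of_nat ((n + k - 1) choose n)"
  using one_minus_const_fps_X_neg_power'[OF assms, of "1 :: rat"]
  by (simp add: add.commute)

section \<open>From partitions to compositions\<close>

text \<open>The factorials alone count rearrangements, so the product of the parts has to be
  separated from them.\<close>

lemma z_part_eq: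
  "z_part \<mu> = prod_list \<mu> * (\<Prod>i\<in>set \<mu>. fact (count_list \<mu> i))"
proof -
  have "prod_list \<mu> = (\<Prod>i\<in>set \<mu>. i ^ count_list \<mu> i)"
    using prod_mset_multiplicity[of "mset \<mu>"] by (simp add: prod_mset_prod_list count_mset)
  then show ?thesis by (simp add: z_part_def prod.distrib)
qed

lemma rearrangements_count:
  assumes "\<forall>k\<in>set \<mu>. k \<ge> (1::nat)"
  shows "of_nat (card (permutations_of_multiset (mset \<mu>))) / (of_nat (prod_list \<mu>) :: rat)
       = fact (length \<mu>) / of_nat (z_part \<mu>)"
proof -
  define c where "c = (\<Prod>i\<in>set \<mu>. fact (count_list \<mu> i) :: nat)"
  have "card (permutations_of_multiset (mset \<mu>)) * c = fact (length \<mu>)"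
    using card_permutations_of_multiset_aux[of "mset \<mu>"] by (simp add: c_def count_mset)
  then have "of_nat (card (permutations_of_multiset (mset \<mu>))) * of_nat c = (fact (length \<mu>) :: rat)"
    by (metis of_nat_fact of_nat_mult)
  moreover have "prod_list \<mu> \<noteq> 0"
    using assms by (auto simp: prod_list_zero_iff)
  moreover have "c \<noteq> 0" by (simp add: c_def)
  moreover have "z_part \<mu> = prod_list \<mu> * c" by (simp add: z_part_eq c_def)
  ultimately show ?thesis by (simp add: field_simps)
qed

text \<open>Sorting maps the compositions of \<open>n\<close> onto the partitions, with the rearrangements as
  fibres. The set \<open>natpermute n p\<close> also contains lists with zero entries; these contribute
  nothing because their product is 0 and division by 0 yields 0.\<close>

lemma sum_partitions_eq_sum_compositions:
  fixes f :: "nat multiset \<Rightarrow> rat"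
  shows "fact p * (\<Sum>\<mu>\<in>partitions n p. f (mset \<mu>) / of_nat (z_part \<mu>))
       = (\<Sum>v\<in>natpermute n p. f (mset v) / of_nat (prod_list v))"
proof -
  define C where "C = {v \<in> natpermute n p. \<forall>k\<in>set v. k \<ge> 1}"
  have perm: "{v \<in> C. rev (sort v) = \<mu>} = permutations_of_multiset (mset \<mu>)"
    if "\<mu> \<in> partitions n p" for \<mu>
  proof (intro equalityI subsetI)
    fix v assume "v \<in> {v \<in> C. rev (sort v) = \<mu>}"
    then show "v \<in> permutations_of_multiset (mset \<mu>)"
      by (auto simp: permutations_of_multiset_def)
  next
    fix v assume "v \<in> permutations_of_multiset (mset \<mu>)"
    then have m: "mset v = mset \<mu>" by (simp add: permutations_of_multiset_def)
    have "length v = length \<mu>" "sum_list v = sum_list \<mu>" "set v = set \<mu>"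
      using mset_eq_length[OF m] mset_eq_setD[OF m] sum_mset_sum_list[of v]
      by (simp_all add: m sum_mset_sum_list)
    moreover have "sorted (rev \<mu>)"
      using that by (simp add: partitions_def is_partition_def sorted_wrt_rev)
    then have "rev \<mu> = sort v"
      using m by (metis mset_rev properties_for_sort)
    then have "rev (sort v) = \<mu>" by (metis rev_rev_ident)
    ultimately show "v \<in> {v \<in> C. rev (sort v) = \<mu>}"
      using that by (auto simp: C_def natpermute_def partitions_def is_partition_def)
  qed
  have img: "(\<lambda>v. rev (sort v)) ` C \<subseteq> partitions n p"
    by (auto simp: C_def partitions_def natpermute_def is_partition_def sorted_wrt_rev
        simp flip: sum_mset_sum_list)
  have fin: "finite C" by (simp add: C_def natpermute_finite)
  have "(\<Sum>v\<in>natpermute n p. f (mset v) / of_nat (prod_list v))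
      = (\<Sum>v\<in>C. f (mset v) / of_nat (prod_list v))"
    by (rule sum.mono_neutral_right)
       (auto simp: C_def natpermute_finite prod_list_zero_iff not_less_eq_eq)
  also have "\<dots> = (\<Sum>\<mu>\<in>partitions n p. \<Sum>v | v \<in> C \<and> rev (sort v) = \<mu>.
                      f (mset v) / of_nat (prod_list v))"
    by (rule sum.group[OF fin finite_partitions img, symmetric])
  also have "\<dots> = (\<Sum>\<mu>\<in>partitions n p. fact p * (f (mset \<mu>) / of_nat (z_part \<mu>)))"
  proof (rule sum.cong[OF refl])
    fix \<mu> assume \<mu>: "\<mu> \<in> partitions n p"
    have "(\<Sum>v\<in>permutations_of_multiset (mset \<mu>). f (mset v) / of_nat (prod_list v))
        = (\<Sum>v\<in>permutations_of_multiset (mset \<mu>). f (mset \<mu>) / of_nat (prod_list \<mu>))"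
      by (intro sum.cong refl)
         (auto simp: permutations_of_multiset_def simp flip: prod_mset_prod_list)
    also have "\<dots> = f (mset \<mu>) * (of_nat (card (permutations_of_multiset (mset \<mu>)))
                                     / of_nat (prod_list \<mu>))"
      by simp
    also have "\<dots> = f (mset \<mu>) * (fact p / of_nat (z_part \<mu>))"
      using \<mu> rearrangements_count[of \<mu>] by (auto simp: partitions_def is_partition_def)
    finally show "(\<Sum>v | v \<in> C \<and> rev (sort v) = \<mu>. f (mset v) / of_nat (prod_list v))
        = fact p * (f (mset \<mu>) / of_nat (z_part \<mu>))"
      using perm[OF \<mu>] by simp
  qed
  finally show ?thesis by (simp add: sum_distrib_left)
qed

section \<open>Counting the choices of points\<close>

text \<open>This is \<open>(1 + q)\<^sup>m - 1\<close>, the generating function of the nonempty subsets of a row of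
  length \<open>m\<close>.\<close>

definition row_fps :: "nat \<Rightarrow> rat fps" where
  "row_fps m = Abs_fps (\<lambda>b. if b = 0 then 0 else of_nat (m choose b))"

lemma card_subsets_with_row_sizes:
  assumes "finite I" "\<And>i. i \<in> I \<Longrightarrow> finite (A i)"
  shows "card {S. S \<subseteq> Sigma I A \<and> (\<forall>i\<in>I. card (S `` {i}) = b i)}
       = (\<Prod>i\<in>I. card (A i) choose b i)"
proof -
  let ?F = "PiE I (\<lambda>i. {T. T \<subseteq> A i \<and> card T = b i})"
  have "bij_betw (\<lambda>S. restrict (\<lambda>i. S `` {i}) I)
          {S. S \<subseteq> Sigma I A \<and> (\<forall>i\<in>I. card (S `` {i}) = b i)} ?F"
    by (rule bij_betw_byWitness[where f' = "Sigma I"])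
       (force simp: PiE_def Pi_def extensional_def Image_def fun_eq_iff)+
  then have "card {S. S \<subseteq> Sigma I A \<and> (\<forall>i\<in>I. card (S `` {i}) = b i)} = card ?F"
    by (rule bij_betw_same_card)
  also have "\<dots> = (\<Prod>i\<in>I. card (A i) choose b i)"
    using assms by (simp add: card_PiE n_subsets)
  finally show ?thesis .
qed

lemma diagram_eq_Sigma: "diagram \<mu> = (SIGMA i:{1..length \<mu>}. {1..part \<mu> i})"
  by (auto simp: diagram_def)

text \<open>Group the choices by the list \<open>R S\<close> of the numbers of points in the rows; the condition
  that no row is missed says that this list has no zero entry. The result is written as a product
  of series, rather than as a sum over lists, because it is then visibly symmetric in the
  parts.\<close>

lemma row_choices_eq:
  "of_nat (row_choices \<mu> r) = prod_list (map row_fps \<mu>) $ r"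
proof -
  define p where "p = length \<mu>"
  define R where "R S = map (\<lambda>i. card (S `` {Suc i})) [0..<p]" for S :: "(nat \<times> nat) set"
  define U where "U = {S. S \<subseteq> diagram \<mu> \<and> card S = r \<and>
     (\<forall>i\<in>{1..length \<mu>}. \<exists>j. (i, j) \<in> S)}"
  define V where "V = {v \<in> natpermute r p. \<forall>i<p. v ! i > 0}"
  have finrow: "finite (S `` {i})" and cardS: "card S = (\<Sum>i<p. card (S `` {Suc i}))"
    if "S \<subseteq> diagram \<mu>" for S i
  proof -
    have finS: "finite S" using that finite_diagram finite_subset by blast
    then show fr: "finite (S `` {i})" for i by (rule finite_Image)
    have "S = (SIGMA i:{1..p}. S `` {i})"
      using that by (auto simp: diagram_eq_Sigma p_def)
    then have "card S = (\<Sum>i\<in>{1..p}. card (S `` {i}))"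
      using fr card_SigmaI by (metis finite_atLeastAtMost)
    also have "{1..p} = Suc ` {..<p}"
      by (simp add: image_Suc_lessThan)
    finally show "card S = (\<Sum>i<p. card (S `` {Suc i}))"
      by (simp add: sum.reindex)
  qed
  have finU: "finite U"
    using finite_subset[of U "Pow (diagram \<mu>)"] by (auto simp: U_def finite_diagram)
  have finV: "finite V" by (simp add: V_def natpermute_finite)
  have img: "R ` U \<subseteq> V"
  proof
    fix v assume "v \<in> R ` U"
    then obtain S where S: "S \<in> U" "v = R S" by blast
    then have sub: "S \<subseteq> diagram \<mu>" by (simp add: U_def)
    have "card (S `` {Suc i}) > 0" if "i < p" for i
    proof -
      have "\<exists>j. (Suc i, j) \<in> S" using S(1) that by (auto simp: U_def p_def)
      then show ?thesis using finrow[OF sub] by (auto simp: card_gt_0_iff)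
    qed
    moreover have "sum_list v = r"
      using S cardS[OF sub] by (simp add: R_def U_def sum_list_sum_nth atLeast0LessThan)
    ultimately show "v \<in> V" using S(2) by (simp add: V_def natpermute_def R_def)
  qed
  have fibre: "card {S \<in> U. R S = v} = (\<Prod>i<p. (\<mu> ! i) choose (v ! i))" if v: "v \<in> V" for v
  proof -
    have lv: "length v = p" "(\<Sum>i<p. v ! i) = r" "\<forall>i<p. v ! i > 0"
      using v natpermuteD[of v r p] by (auto simp: V_def)
    have Req: "R S = v \<longleftrightarrow> (\<forall>i<p. card (S `` {Suc i}) = v ! i)" for S
      using lv(1) by (auto simp: R_def list_eq_iff_nth_eq)
    have all: "(\<forall>i<p. P (Suc i)) \<longleftrightarrow> (\<forall>i\<in>{1..p}. P i)" for P
      by (metis atLeastAtMost_iff image_Suc_lessThan image_iff lessThan_iff)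
    have "{S \<in> U. R S = v} =
        {S. S \<subseteq> (SIGMA i:{1..p}. {1..part \<mu> i}) \<and> (\<forall>i\<in>{1..p}. card (S `` {i}) = v ! (i - 1))}"
      (is "_ = ?W")
    proof (intro equalityI subsetI)
      fix S assume "S \<in> {S \<in> U. R S = v}"
      then show "S \<in> ?W"
        using all[of "\<lambda>i. card (S `` {i}) = v ! (i - 1)"]
        by (auto simp: Req U_def diagram_eq_Sigma p_def)
    next
      fix S assume S: "S \<in> ?W"
      then have sub: "S \<subseteq> diagram \<mu>" by (simp add: diagram_eq_Sigma p_def)
      have RS: "\<forall>i<p. card (S `` {Suc i}) = v ! i"
        using S all[of "\<lambda>i. card (S `` {i}) = v ! (i - 1)"] by simp
      have "card S = r" using cardS[OF sub] RS lv(2) by simp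
      moreover have "\<exists>j. (i, j) \<in> S" if "i \<in> {1..p}" for i
      proof -
        have "card (S `` {i}) > 0" using S lv(3) that by auto
        then have "S `` {i} \<noteq> {}" by fastforce
        then show ?thesis by auto
      qed
      ultimately show "S \<in> {S \<in> U. R S = v}"
        using sub RS Req by (auto simp: U_def p_def)
    qed
    then have "card {S \<in> U. R S = v} = (\<Prod>i\<in>{1..p}. card {1..part \<mu> i} choose (v ! (i - 1)))"
      by (simp only: card_subsets_with_row_sizes finite_atLeastAtMost)
    also have "{1..p} = Suc ` {..<p}"
      by (simp add: image_Suc_lessThan)
    finally show ?thesis by (simp add: prod.reindex part_def)
  qed
  have "row_choices \<mu> r = card U" by (simp add: row_choices_def U_def)
  also have "\<dots> = (\<Sum>v\<in>V. card {S \<in> U. R S = v})"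
    using sum.group[OF finU finV img, of "\<lambda>_. 1::nat"] by simp
  also have "\<dots> = (\<Sum>v\<in>V. \<Prod>i<p. (\<mu> ! i) choose (v ! i))"
    using fibre by simp
  finally have "(of_nat (row_choices \<mu> r) :: rat)
      = (\<Sum>v\<in>V. \<Prod>i<p. of_nat ((\<mu> ! i) choose (v ! i)))" by simp
  also have "\<dots> = (\<Sum>v\<in>V. \<Prod>i<p. row_fps (\<mu> ! i) $ (v ! i))"
    by (intro sum.cong prod.cong) (auto simp: V_def row_fps_def)
  also have "\<dots> = (\<Sum>v\<in>natpermute r p. \<Prod>i<p. row_fps (\<mu> ! i) $ (v ! i))"
    by (rule sum.mono_neutral_left)
       (auto simp: V_def natpermute_finite row_fps_def)
  also have "\<dots> = (\<Prod>i<p. row_fps (\<mu> ! i)) $ r"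
    by (rule fps_prod_lessThan_nth[symmetric])
  also have "(\<Prod>i<p. row_fps (\<mu> ! i)) = prod_list (map row_fps \<mu>)"
    by (simp add: prod.list_conv_set_nth p_def atLeast0LessThan)
  finally show ?thesis .
qed

section \<open>Summing over compositions\<close>

text \<open>For \<open>t = 0\<close> this is \<open>1 / a\<close>, the contribution of an unmarked part, and for
  \<open>t = s\<close> that of the marked part. The value at \<open>a = 0\<close> is 0 by division by 0, which
  discards the zero entries of lists in \<open>natpermute\<close>.\<close>

definition weight :: "nat \<Rightarrow> nat \<Rightarrow> rat" where
  "weight t a = pochhammer (of_nat a) t / (fact t * of_nat a)"

lemma weight_0 [simp]: "weight t 0 = 0"
  by (simp add: weight_def)

lemma weight_eq_fact:
  assumes "a > 0"
  shows "weight t a = fact (a + t - 1) / (fact a * fact t)"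
proof -
  have "fact (a - 1) * pochhammer (of_nat a :: rat) t = fact (a + t - 1)"
    using assms pochhammer_product'[of "1::rat" "a - 1" t]
    by (simp add: pochhammer_fact of_nat_diff)
  moreover have "(fact a :: rat) = of_nat a * fact (a - 1)"
    using assms by (simp add: fact_reduce)
  ultimately show ?thesis using assms
    by (simp add: weight_def field_simps)
qed

text \<open>For \<open>b \<le> a\<close>, after cancellation of \<open>a!\<close>, both sides are
  \<open>(a + t - 1)! / (t! b! (a - b)!)\<close>, since the series on the right has the coefficient
  \<open>(a + t - 1 choose a - b)\<close> at \<open>a\<close>. The variable \<open>a\<close> now occurs on the right only as
  an index, which is what makes the sum over \<open>a\<close> a coefficient of a product.\<close>

lemma weight_mult_row_fps:
  assumes "b > 0"
  shows "weight t a * row_fps a $ b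
       = weight t b * (fps_X ^ b * inverse ((1 - fps_X) ^ (b + t))) $ a"
proof (cases "b \<le> a")
  case True
  then have a: "a > 0" using assms by simp
  have "a - b + (b + t) - 1 = a + t - 1" using True by simp
  then have "(fps_X ^ b * inverse ((1 - fps_X) ^ (b + t)) :: rat fps) $ a
      = of_nat ((a + t - 1) choose (a - b))"
    using True assms by (simp add: fps_X_power_mult_nth inverse_one_minus_fps_X_power_nth)
  also have "\<dots> = fact (a + t - 1) / (fact (a - b) * fact (b + t - 1))"
  proof -
    have "a + t - 1 - (a - b) = b + t - 1" using True assms by simp
    then show ?thesis using True assms by (simp add: binomial_fact)
  qed
  finally show ?thesis
    using True assms a by (simp add: weight_eq_fact row_fps_def binomial_fact)
next
  case False
  then show ?thesis by (simp add: row_fps_def fps_X_power_mult_nth)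
qed

text \<open>For \<open>t = 0\<close> this is \<open>L = - log (1 - X)\<close>, and for \<open>t > 0\<close> it is
  \<open>((1 - X)\<^bsup>-t\<^esup> - 1) / t\<close>.\<close>

definition weight_fps :: "nat \<Rightarrow> rat fps" where
  "weight_fps t = Abs_fps (weight t)"

lemma weight_fps_nth [simp]: "weight_fps t $ a = weight t a"
  by (simp add: weight_fps_def)

text \<open>After exchanging the sums over \<open>a\<close> and \<open>b\<close>, the series \<open>E\<close> of the rows multiply to
  \<open>X\<^sup>r / (1 - X)\<^bsup>r+T\<^esup>\<close>, where \<open>T\<close> is the sum of the \<open>t i\<close>, for every composition
  \<open>b\<close> of \<open>r\<close>. The inner sum is therefore a constant and factors out.\<close>

lemma sum_compositions_weight:
  fixes t :: "nat \<Rightarrow> nat"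
  assumes "r > 0"
  shows "(\<Sum>a\<in>natpermute n p. (\<Prod>i<p. weight (t i) (a ! i)) * (\<Prod>i<p. row_fps (a ! i)) $ r)
       = of_nat (if r \<le> n then (n + (\<Sum>i<p. t i) - 1) choose (n - r) else 0) *
         (\<Prod>i<p. weight_fps (t i)) $ r"
proof -
  define T where "T = (\<Sum>i<p. t i)"
  define E :: "nat \<Rightarrow> nat \<Rightarrow> rat fps" where "E t b = fps_X ^ b * inverse ((1 - fps_X) ^ (b + t))" for t b
  define B where "B = (of_nat (if r \<le> n then (n + T - 1) choose (n - r) else 0) :: rat)"
  have w: "weight t a * row_fps a $ b = weight t b * E t b $ a" for t a b
  proof (cases "b = 0")
    case True
    then show ?thesis by (simp add: row_fps_def)
  qed (simp add: weight_mult_row_fps E_def)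
  have E: "(\<Prod>i<p. E (t i) (b ! i)) $ n = B" if "b \<in> natpermute r p" for b
  proof -
    have "(\<Prod>i<p. E (t i) (b ! i)) = fps_X ^ r * inverse ((1 - fps_X) ^ (r + T))"
      using natpermuteD(3)[OF that]
      by (simp add: E_def prod.distrib T_def fps_inverse_power sum.distrib flip: power_sum)
    then show ?thesis using assms
      by (simp add: B_def fps_X_power_mult_nth inverse_one_minus_fps_X_power_nth)
  qed
  have "(\<Sum>a\<in>natpermute n p. (\<Prod>i<p. weight (t i) (a ! i)) * (\<Prod>i<p. row_fps (a ! i)) $ r)
      = (\<Sum>a\<in>natpermute n p. \<Sum>b\<in>natpermute r p.
           \<Prod>i<p. weight (t i) (a ! i) * row_fps (a ! i) $ (b ! i))"
    by (simp add: fps_prod_lessThan_nth sum_distrib_left prod.distrib)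
  also have "\<dots> = (\<Sum>b\<in>natpermute r p. \<Sum>a\<in>natpermute n p.
           \<Prod>i<p. weight (t i) (b ! i) * E (t i) (b ! i) $ (a ! i))"
    unfolding w by (rule sum.swap)
  also have "\<dots> = (\<Sum>b\<in>natpermute r p. (\<Prod>i<p. weight (t i) (b ! i)) *
                       (\<Prod>i<p. E (t i) (b ! i)) $ n)"
    by (simp add: fps_prod_lessThan_nth sum_distrib_left prod.distrib)
  also have "\<dots> = (\<Sum>b\<in>natpermute r p. (\<Prod>i<p. weight (t i) (b ! i)) * B)"
    using E by simp
  also have "\<dots> = B * (\<Prod>i<p. weight_fps (t i)) $ r"
    by (simp add: fps_prod_lessThan_nth sum_distrib_left mult.commute)
  finally show ?thesis by (simp add: B_def T_def)
qed

section \<open>Stirling numbers\<close>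

lemma fps_deriv_weight_fps_0: "(1 - fps_X) * fps_deriv (weight_fps 0) = 1"
proof (rule fps_ext)
  fix m
  have "of_nat (Suc k) * weight 0 (Suc k) = 1" for k
    by (simp add: weight_def del: of_nat_Suc)
  then show "((1 - fps_X) * fps_deriv (weight_fps 0)) $ m = (1 :: rat fps) $ m"
    by (cases m) (simp_all add: algebra_simps del: of_nat_Suc)
qed

text \<open>From \<open>(1 - X) L' = 1\<close> follows \<open>(1 - X) (L\<^bsup>l+1\<^esup>)' = (l + 1) L\<^sup>l\<close>; comparing
  coefficients gives the recurrence of the Stirling numbers.\<close>

lemma stirling_egf: "fact m * (weight_fps 0 ^ k) $ m = fact k * of_nat (stirling m k)"
proof (induction m arbitrary: k)
  case 0
  then show ?case by (cases k) simp_all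
next
  case (Suc m)
  show ?case
  proof (cases k)
    case (Suc l)
    let ?L = "weight_fps 0"
    have "(1 - fps_X) * fps_deriv (?L ^ Suc l) = of_nat (Suc l) * ?L ^ l * ((1 - fps_X) * fps_deriv ?L)"
      by (simp only: fps_deriv_power' diff_Suc_1 mult_ac)
    then have "((1 - fps_X) * fps_deriv (?L ^ Suc l)) $ m = (of_nat (Suc l) * ?L ^ l) $ m"
      by (simp only: fps_deriv_weight_fps_0 mult_1_right)
    moreover have "((1 - fps_X) * fps_deriv (?L ^ Suc l)) $ m
        = of_nat (Suc m) * (?L ^ Suc l) $ Suc m - of_nat m * (?L ^ Suc l) $ m"
      by (cases m) (simp_all add: left_diff_distrib del: power_Suc of_nat_Suc)
    moreover have "(of_nat (Suc l) * ?L ^ l) $ m = of_nat (Suc l) * (?L ^ l) $ m"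
      by (simp only: fps_mult_of_nat_nth)
    ultimately have "of_nat (Suc m) * (?L ^ Suc l) $ Suc m
        = of_nat m * (?L ^ Suc l) $ m + of_nat (Suc l) * (?L ^ l) $ m" by simp
    then have "fact m * (of_nat (Suc m) * (?L ^ Suc l) $ Suc m)
        = fact m * (of_nat m * (?L ^ Suc l) $ m + of_nat (Suc l) * (?L ^ l) $ m)" by simp
    then have "fact (Suc m) * (?L ^ Suc l) $ Suc m
        = of_nat m * (fact m * (?L ^ Suc l) $ m) + of_nat (Suc l) * (fact m * (?L ^ l) $ m)"
      by (simp only: fact_Suc of_nat_mult of_nat_fact distrib_left mult_ac)
    also have "\<dots> = fact (Suc l) * of_nat (stirling (Suc m) (Suc l))"
      unfolding Suc.IH by (simp add: algebra_simps)
    finally show ?thesis using Suc by simp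
  qed simp
qed

text \<open>This is the coefficient form of \<open>((1 - X)\<^bsup>-s\<^esup> - 1) / s = (exp (s L) - 1) / s\<close>. Up to the factor \<open>s b!\<close> the left-hand side is the rising
  factorial of \<open>s\<close>, whose expansion in powers of \<open>s\<close> has Stirling numbers as coefficients.
  Since \<open>L\<^sup>k\<close> has no terms below \<open>X\<^sup>k\<close>, any bound \<open>r\<close> not less than \<open>b\<close> may be used,
  so that one finite sum serves all \<open>b\<close> up to \<open>r\<close>.\<close>

lemma weight_eq_sum:
  assumes "s > 0" "b \<le> r"
  shows "weight s b = (\<Sum>k=1..r. of_nat s ^ (k - 1) / fact k * (weight_fps 0 ^ k) $ b)"
proof (cases "b = 0")
  case True
  have "(\<Sum>k=1..r. of_nat s ^ (k - 1) / fact k * (weight_fps 0 ^ k) $ 0) = 0"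
    by (intro sum.neutral) auto
  then show ?thesis using True by simp
next
  case False
  have "fact (s - 1) * pochhammer (of_nat s :: rat) b = fact (s + b - 1)"
    using assms pochhammer_product'[of "1::rat" "s - 1" b]
    by (simp add: pochhammer_fact of_nat_diff)
  moreover have "(fact s :: rat) = of_nat s * fact (s - 1)"
    using assms by (simp add: fact_reduce)
  ultimately have "weight s b = pochhammer (of_nat s) b / (of_nat s * fact b)"
    using False assms(1) by (simp add: weight_eq_fact field_simps)
  also have "pochhammer (of_nat s :: rat) b = (\<Sum>k\<le>b. of_nat (stirling b k) * of_nat s ^ k)"
    by (simp add: stirling_pochhammer)
  also have "\<dots> = (\<Sum>k=1..r. of_nat (stirling b k) * of_nat s ^ k)"
  proof (rule sum.mono_neutral_cong)
    show "of_nat (stirling b k) * of_nat s ^ k = (0::rat)" if "k \<in> {..b} - {1..r}" for k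
      using that assms False by (cases b) (auto simp: not_less_eq_eq)
  qed auto
  also have "\<dots> / (of_nat s * fact b) = (\<Sum>k=1..r. of_nat s ^ (k - 1) / fact k * (weight_fps 0 ^ k) $ b)"
    unfolding sum_divide_distrib
  proof (rule sum.cong[OF refl])
    fix k assume "k \<in> {1..r}"
    then obtain l where k: "k = Suc l" by (cases k) auto
    have "(weight_fps 0 ^ k) $ b = fact k * of_nat (stirling b k) / fact b"
      using stirling_egf[of b k] by (simp add: field_simps)
    then show "of_nat (stirling b k) * of_nat s ^ k / (of_nat s * fact b)
        = of_nat s ^ (k - 1) / fact k * (weight_fps 0 ^ k) $ b"
      using assms(1) by (simp add: k)
  qed
  finally show ?thesis .
qed

text \<open>Multiplying the expansion of \<open>weight_fps s\<close> by \<open>L\<^bsup>p-1\<^esup>\<close> turns the \<open>k\<close>-th term into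
  a power of \<open>L\<close> with exponent \<open>j = k + p - 1\<close>. The factor \<open>j! / (j - p + 1)!\<close> that arises
  from \<open>stirling_egf\<close> is the binomial coefficient times \<open>(p - 1)!\<close>.\<close>

lemma weight_fps_mult_power_nth:
  assumes "s > 0" "1 \<le> p" "p \<le> r"
  shows "fact r * (weight_fps s * weight_fps 0 ^ (p - 1)) $ r
       = fact (p - 1) * (\<Sum>j=p..r. of_nat (j choose (p - 1)) * of_nat (stirling r j) * of_nat s ^ (j - p))"
proof -
  define S where "S = (\<Sum>k=1..r. fps_const (of_nat s ^ (k - 1) / fact k) * weight_fps 0 ^ k)"
  have S: "weight s b = S $ b" if "b \<le> r" for b
    using weight_eq_sum[OF assms(1) that] by (simp add: S_def fps_sum_nth)
  \<comment> \<open>The coefficient at \<open>r\<close> of a product sees its factors only up to \<open>r\<close>, where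
    \<open>weight_fps s\<close> agrees with the polynomial \<open>S\<close> in \<open>L\<close>.\<close>
  have "(weight_fps s * weight_fps 0 ^ (p - 1)) $ r = (S * weight_fps 0 ^ (p - 1)) $ r"
    unfolding fps_mult_nth by (intro sum.cong refl) (simp add: S)
  also have "S * weight_fps 0 ^ (p - 1)
      = (\<Sum>k=1..r. fps_const (of_nat s ^ (k - 1) / fact k) * weight_fps 0 ^ (k + (p - 1)))"
    by (simp add: S_def sum_distrib_right power_add mult.assoc)
  finally have "fact r * (weight_fps s * weight_fps 0 ^ (p - 1)) $ r
      = (\<Sum>k=1..r. of_nat s ^ (k - 1) / fact k * (fact r * (weight_fps 0 ^ (k + (p - 1))) $ r))"
    by (simp add: fps_sum_nth sum_distrib_left mult_ac)
  also have "\<dots> = (\<Sum>k=1..r. of_nat s ^ (k - 1) / fact k *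
                      (fact (k + (p - 1)) * of_nat (stirling r (k + (p - 1)))))"
    unfolding stirling_egf ..
  also have "\<dots> = (\<Sum>k=1..r - (p - 1). of_nat s ^ (k - 1) / fact k *
                      (fact (k + (p - 1)) * of_nat (stirling r (k + (p - 1)))))"
    by (rule sum.mono_neutral_right) auto
  also have "\<dots> = (\<Sum>j=p..r. of_nat s ^ (j - p) / fact (j - (p - 1)) *
                      (fact j * of_nat (stirling r j)))"
    by (rule sum.reindex_bij_witness[of _ "\<lambda>j. j - (p - 1)" "\<lambda>k. k + (p - 1)"])
       (use assms in auto)
  also have "\<dots> = fact (p - 1) *
      (\<Sum>j=p..r. of_nat (j choose (p - 1)) * of_nat (stirling r j) * of_nat s ^ (j - p))"
    unfolding sum_distrib_left
    by (intro sum.cong refl) (auto simp: binomial_fact field_simps)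
  finally show ?thesis .
qed

section \<open>The identity\<close>

lemma part_sum_eq: "(\<Sum>i=1..length \<mu>. f (part \<mu> i)) = sum_mset (image_mset f (mset \<mu>))"
proof -
  have "{1..length \<mu>} = Suc ` {..<length \<mu>}"
    by (simp add: image_Suc_lessThan)
  then have "(\<Sum>i=1..length \<mu>. f (part \<mu> i)) = sum_list (map f \<mu>)"
    by (simp add: sum.reindex part_def sum_list_sum_nth atLeast0LessThan)
  then show ?thesis by (simp flip: sum_mset_sum_list)
qed

theorem mainTheorem2:
  fixes n r s p :: nat
  assumes "n \<ge> 1" and "r \<ge> 1" and "s \<ge> 1" and "1 \<le> p" and "p \<le> r"
  shows "fact r * (\<Sum>\<mu>\<in>partitions n p.
            of_nat (row_choices \<mu> r) / of_nat (z_part \<mu>) *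
            (\<Sum>i=1..length \<mu>. pochhammer (of_nat (part \<mu> i)) s / fact s))
       = (of_nat (if r \<le> n then (n + s - 1) choose (n - r) else 0) :: rat) *
         (\<Sum>j=p..r. of_nat (j choose (p - 1)) * of_int \<bar>stirling_first r j\<bar> * of_nat s ^ (j - p))"
proof -
  define h where "h a = (pochhammer (of_nat a) s / fact s :: rat)" for a :: nat
  define f where "f M = prod_mset (image_mset row_fps M) $ r * sum_mset (image_mset h M)" for M
  define B where "B = (of_nat (if r \<le> n then (n + s - 1) choose (n - r) else 0) :: rat)"
  let ?P = "\<Sum>\<mu>\<in>partitions n p. of_nat (row_choices \<mu> r) / of_nat (z_part \<mu>) *
            (\<Sum>i=1..length \<mu>. pochhammer (of_nat (part \<mu> i)) s / fact s :: rat)"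
  have "?P = (\<Sum>\<mu>\<in>partitions n p. f (mset \<mu>) / of_nat (z_part \<mu>))"
    using part_sum_eq[of h]
    by (intro sum.cong refl) (simp add: f_def h_def row_choices_eq prod_mset_prod_list flip: mset_map)
  then have "fact p * ?P = (\<Sum>a\<in>natpermute n p. f (mset a) / of_nat (prod_list a))"
    by (simp add: sum_partitions_eq_sum_compositions)
  \<comment> \<open>The index \<open>i\<close> is the marked part.\<close>
  also have "\<dots> = (\<Sum>a\<in>natpermute n p. \<Sum>i<p.
      (\<Prod>j<p. weight (if j = i then s else 0) (a ! j)) * (\<Prod>j<p. row_fps (a ! j)) $ r)"
  proof (rule sum.cong[OF refl])
    fix a assume "a \<in> natpermute n p"
    then have len: "length a = p" by (rule natpermuteD)
    have w: "(\<Prod>j<p. weight (if j = i then s else 0) (a ! j)) = h (a ! i) / of_nat (prod_list a)"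
      if "i < p" for i
    proof -
      have "(\<Prod>j<p. weight (if j = i then s else 0) (a ! j))
          = (\<Prod>j<p. (if j = i then h (a ! j) else 1) / of_nat (a ! j))"
        by (intro prod.cong refl) (simp add: weight_def h_def)
      also have "\<dots> = h (a ! i) / (\<Prod>j<p. of_nat (a ! j))"
        using that by (simp add: prod_dividef prod.delta)
      finally show ?thesis using len by (simp add: prod.list_conv_set_nth atLeast0LessThan)
    qed
    have "prod_mset (image_mset row_fps (mset a)) = (\<Prod>j<p. row_fps (a ! j))"
      using len by (simp add: prod_mset_prod_list prod.list_conv_set_nth atLeast0LessThan flip: mset_map)
    moreover have "sum_mset (image_mset h (mset a)) = (\<Sum>i<p. h (a ! i))"
      using len by (simp add: sum_mset_sum_list sum_list_sum_nth atLeast0LessThan flip: mset_map)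
    ultimately show "f (mset a) / of_nat (prod_list a) = (\<Sum>i<p.
      (\<Prod>j<p. weight (if j = i then s else 0) (a ! j)) * (\<Prod>j<p. row_fps (a ! j)) $ r)"
      by (simp add: f_def w sum_distrib_right sum_divide_distrib mult.commute)
  qed
  also have "\<dots> = (\<Sum>i<p. B * (\<Prod>j<p. weight_fps (if j = i then s else 0)) $ r)"
    using assms by (subst sum.swap) (simp add: sum_compositions_weight B_def)
  \<comment> \<open>The position of the marked part is irrelevant, so the sum over \<open>i\<close> becomes a factor
    \<open>p\<close>, which reduces \<open>p!\<close> to \<open>(p - 1)!\<close>.\<close>
  also have "\<dots> = (\<Sum>i<p. B * (weight_fps s * weight_fps 0 ^ (p - 1)) $ r)"
  proof (intro sum.cong refl)
    fix i assume "i \<in> {..<p}"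
    then have "(\<Prod>j<p. weight_fps (if j = i then s else 0))
        = weight_fps s * (\<Prod>j\<in>{..<p} - {i}. weight_fps 0)"
      by (subst prod.remove[of _ i]) auto
    then show "B * (\<Prod>j<p. weight_fps (if j = i then s else 0)) $ r
        = B * (weight_fps s * weight_fps 0 ^ (p - 1)) $ r"
      using \<open>i \<in> {..<p}\<close> by simp
  qed
  finally have "fact p * ?P = of_nat p * (B * (weight_fps s * weight_fps 0 ^ (p - 1)) $ r)"
    by simp
  moreover have "(fact p :: rat) = of_nat p * fact (p - 1)"
    using assms by (simp add: fact_reduce)
  ultimately have "fact (p - 1) * ?P = B * (weight_fps s * weight_fps 0 ^ (p - 1)) $ r"
    using assms by simp
  then have "fact (p - 1) * (fact r * ?P)
      = B * (fact r * (weight_fps s * weight_fps 0 ^ (p - 1)) $ r)"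
    by (simp add: mult.left_commute)
  also have "\<dots> = fact (p - 1) * (B *
      (\<Sum>j=p..r. of_nat (j choose (p - 1)) * of_nat (stirling r j) * of_nat s ^ (j - p)))"
    using assms by (subst weight_fps_mult_power_nth) (simp_all add: mult.left_commute)
  finally show ?thesis by (simp add: B_def abs_stirling_first)
qed

end
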